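(* Let $\sigma$ be a spectral function. Then $(L_\sigma,\|\cdot\|_\sigma)$ is a Banach space over $\mathbb{R}$.
   Context: Let $(\Omega,\mathcal{F},P)$ be a probability space and $L^0$ the space of real-valued random variables, identified when almost surely equal. A spectral function is a nondecreasing function $\sigma:[0,1)\to[0,\infty)$ with $\int_0^1\sigma(u)\,du=1$. For a random variable $Y$ and $0<u<1$ let $F_Y^{-1}(u):=\inf\{y:P(Y\le y)\ge u\}$, and let $\rho_\sigma(Y):=\int_0^1\sigma(u)F_Y^{-1}(u)\,du$ when the integral exists. Put $\|Y\|_\sigma:=\rho_\sigma(|Y|)\in[0,\infty]$ for $Y\in L^0$ and $L_\sigma:=\{Y\in L^0:\|Y\|_\sigma<\infty\}$. *)

theory Defs
  imports "HOL-Probability.Probability" "HOL-Algebra.Module" "HOL-Decision_Procs.Algebra_Aux"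
begin

section \<open>Banach spaces given by a carrier set\<close>

text \<open>
  Spaces of classes of random variables depend on a measure, so they are not types and the
  type class \<^class>\<open>banach\<close> does not apply. A real vector space is rendered as a module over
  the field of reals, \<open>cring_class_ops :: real ring\<close>.
\<close>

locale normed_vector_space =
  Module.module "cring_class_ops :: real ring" V
  for V :: "(real, 'v) module" (structure) +
  fixes N :: "'v \<Rightarrow> real"
  assumes norm_nonneg: "x \<in> carrier V \<Longrightarrow> 0 \<le> N x"
    and norm_eq_0_iff: "x \<in> carrier V \<Longrightarrow> N x = 0 \<longleftrightarrow> x = \<zero>\<^bsub>V\<^esub>"
    and norm_smult: "x \<in> carrier V \<Longrightarrow> N (a \<odot>\<^bsub>V\<^esub> x) = \<bar>a\<bar> * N x"
    and norm_triangle: "\<lbrakk>x \<in> carrier V; y \<in> carrier V\<rbrakk> \<Longrightarrow> N (x \<oplus>\<^bsub>V\<^esub> y) \<le> N x + N y"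

text \<open>
  The locale \<^locale>\<open>Metric_space\<close> requires nonnegativity and symmetry also outside the
  carrier, hence the case distinction.
\<close>

definition norm_dist :: "(real, 'v) module \<Rightarrow> ('v \<Rightarrow> real) \<Rightarrow> 'v \<Rightarrow> 'v \<Rightarrow> real" where
  "norm_dist V N x y =
     (if x \<in> carrier V \<and> y \<in> carrier V then N (x \<ominus>\<^bsub>V\<^esub> y) else 0)"

locale banach_space = normed_vector_space V N
  for V :: "(real, 'v) module" and N +
  assumes complete: "Metric_space.mcomplete (carrier V) (norm_dist V N)"


section \<open>Random variables up to almost sure equality\<close>

definition as_eq :: "'a measure \<Rightarrow> (('a \<Rightarrow> real) \<times> ('a \<Rightarrow> real)) set" where
  "as_eq M = {(f, g). f \<in> borel_measurable M \<and> g \<in> borel_measurable M \<and>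
     (AE \<omega> in M. f \<omega> = g \<omega>)}"

definition L0 :: "'a measure \<Rightarrow> ('a \<Rightarrow> real) set set" where
  "L0 M = borel_measurable M // as_eq M"

definition L0_zero :: "'a measure \<Rightarrow> ('a \<Rightarrow> real) set" where
  "L0_zero M = as_eq M `` {\<lambda>\<omega>. 0}"

definition L0_add ::
    "'a measure \<Rightarrow> ('a \<Rightarrow> real) set \<Rightarrow> ('a \<Rightarrow> real) set \<Rightarrow> ('a \<Rightarrow> real) set" where
  "L0_add M X Y = (\<Union>f\<in>X. \<Union>g\<in>Y. as_eq M `` {\<lambda>\<omega>. f \<omega> + g \<omega>})"

definition L0_smult :: "'a measure \<Rightarrow> real \<Rightarrow> ('a \<Rightarrow> real) set \<Rightarrow> ('a \<Rightarrow> real) set" where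
  "L0_smult M a X = (\<Union>f\<in>X. as_eq M `` {\<lambda>\<omega>. a * f \<omega>})"

lemma equiv_as_eq: "equiv (borel_measurable M) (as_eq M)"
proof (rule equivI)
  show "as_eq M \<subseteq> borel_measurable M \<times> borel_measurable M"
    by (auto simp: as_eq_def)
  show "refl_on (borel_measurable M) (as_eq M)"
    by (auto simp: refl_on_def as_eq_def)
  show "sym (as_eq M)"
    by (simp add: sym_def as_eq_def eq_commute)
  show "trans (as_eq M)"
  proof (rule transI)
    fix f g h
    assume fgh: "(f, g) \<in> as_eq M" "(g, h) \<in> as_eq M"
    then have "AE \<omega> in M. f \<omega> = g \<omega>" "AE \<omega> in M. g \<omega> = h \<omega>"
      by (simp_all add: as_eq_def)
    then have "AE \<omega> in M. f \<omega> = h \<omega>"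
      by eventually_elim simp
    with fgh show "(f, h) \<in> as_eq M"
      by (simp add: as_eq_def)
  qed
qed

lemma as_eq_class_eqI: "(f, g) \<in> as_eq M \<Longrightarrow> as_eq M `` {f} = as_eq M `` {g}"
  by (rule equiv_class_eq[OF equiv_as_eq])

lemma L0_add_class:
  assumes "f \<in> borel_measurable M" "g \<in> borel_measurable M"
  shows "L0_add M (as_eq M `` {f}) (as_eq M `` {g}) = as_eq M `` {\<lambda>\<omega>. f \<omega> + g \<omega>}"
proof -
  have "congruent2 (as_eq M) (as_eq M) (\<lambda>f g. as_eq M `` {\<lambda>\<omega>. f \<omega> + g \<omega>})"
  proof (rule congruent2I', rule as_eq_class_eqI)
    fix f f' g g' assume fg: "(f, f') \<in> as_eq M" "(g, g') \<in> as_eq M"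
    then have "AE \<omega> in M. f \<omega> = f' \<omega>" "AE \<omega> in M. g \<omega> = g' \<omega>"
      by (simp_all add: as_eq_def)
    then have "AE \<omega> in M. f \<omega> + g \<omega> = f' \<omega> + g' \<omega>"
      by eventually_elim simp
    moreover have "f \<in> borel_measurable M" "f' \<in> borel_measurable M"
      "g \<in> borel_measurable M" "g' \<in> borel_measurable M"
      using fg by (simp_all add: as_eq_def)
    ultimately show "(\<lambda>\<omega>. f \<omega> + g \<omega>, \<lambda>\<omega>. f' \<omega> + g' \<omega>) \<in> as_eq M"
      by (simp add: as_eq_def)
  qed
  from UN_equiv_class2[OF equiv_as_eq equiv_as_eq this assms]
  show ?thesis
    unfolding L0_add_def .
qed

lemma L0_smult_class:
  assumes "f \<in> borel_measurable M"
  shows "L0_smult M a (as_eq M `` {f}) = as_eq M `` {\<lambda>\<omega>. a * f \<omega>}"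
proof -
  have "congruent (as_eq M) (\<lambda>f. as_eq M `` {\<lambda>\<omega>. a * f \<omega>})"
  proof (rule congruentI, rule as_eq_class_eqI)
    fix f f' assume ff': "(f, f') \<in> as_eq M"
    then have "AE \<omega> in M. f \<omega> = f' \<omega>"
      by (simp add: as_eq_def)
    then have "AE \<omega> in M. a * f \<omega> = a * f' \<omega>"
      by eventually_elim simp
    moreover have "f \<in> borel_measurable M" "f' \<in> borel_measurable M"
      using ff' by (simp_all add: as_eq_def)
    ultimately show "(\<lambda>\<omega>. a * f \<omega>, \<lambda>\<omega>. a * f' \<omega>) \<in> as_eq M"
      by (simp add: as_eq_def)
  qed
  from UN_equiv_class[OF equiv_as_eq this assms]
  show ?thesis
    unfolding L0_smult_def .
qed


section \<open>Spectral risk measures\<close>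

text \<open>Only the values of \<open>\<sigma>\<close> on \<open>[0,1)\<close> are constrained and used.\<close>

definition spectral_function :: "(real \<Rightarrow> real) \<Rightarrow> bool" where
  "spectral_function \<sigma> \<longleftrightarrow>
     mono_on {0..<1} \<sigma> \<and> (\<forall>u\<in>{0..<1}. 0 \<le> \<sigma> u) \<and>
     (\<integral>\<^sup>+u\<in>{0..<1}. ennreal (\<sigma> u) \<partial>lborel) = 1"

definition quantile :: "'a measure \<Rightarrow> ('a \<Rightarrow> real) \<Rightarrow> real \<Rightarrow> real" where
  "quantile M Y u = Inf {y. \<P>(\<omega> in M. Y \<omega> \<le> y) \<ge> u}"

text \<open>
  The integral is taken in the extended sense, as the difference of the integrals of the
  positive and the negative part; it exists unless both are infinite, and in that case the
  value carries no meaning. Note that \<^const>\<open>ennreal\<close> maps negative numbers to \<open>0\<close>.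
\<close>

definition rho :: "'a measure \<Rightarrow> (real \<Rightarrow> real) \<Rightarrow> ('a \<Rightarrow> real) \<Rightarrow> ereal" where
  "rho M \<sigma> Y =
     enn2ereal (\<integral>\<^sup>+u\<in>{0<..<1}. ennreal (\<sigma> u * quantile M Y u) \<partial>lborel) -
     enn2ereal (\<integral>\<^sup>+u\<in>{0<..<1}. ennreal (- (\<sigma> u * quantile M Y u)) \<partial>lborel)"

definition spectral_norm :: "'a measure \<Rightarrow> (real \<Rightarrow> real) \<Rightarrow> ('a \<Rightarrow> real) set \<Rightarrow> ereal" where
  "spectral_norm M \<sigma> X = the_elem ((\<lambda>f. rho M \<sigma> (\<lambda>\<omega>. \<bar>f \<omega>\<bar>)) ` X)"

text \<open>The multiplicative part of the record is irrelevant for modules.\<close>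

definition L_spectral :: "'a measure \<Rightarrow> (real \<Rightarrow> real) \<Rightarrow> (real, ('a \<Rightarrow> real) set) module" where
  "L_spectral M \<sigma> =
     \<lparr>carrier = {X \<in> L0 M. spectral_norm M \<sigma> X < \<infinity>},
      mult = undefined, one = undefined,
      zero = L0_zero M, add = L0_add M, smult = L0_smult M\<rparr>"

lemma rho_cong_AE:
  assumes "(f, g) \<in> as_eq M"
  shows "rho M \<sigma> (\<lambda>\<omega>. \<bar>f \<omega>\<bar>) = rho M \<sigma> (\<lambda>\<omega>. \<bar>g \<omega>\<bar>)"
proof -
  have [measurable]: "f \<in> borel_measurable M" "g \<in> borel_measurable M"
    and ae: "AE \<omega> in M. f \<omega> = g \<omega>"
    using assms by (auto simp: as_eq_def)
  have "\<P>(\<omega> in M. \<bar>f \<omega>\<bar> \<le> y) = \<P>(\<omega> in M. \<bar>g \<omega>\<bar> \<le> y)" for y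
    by (rule measure_eq_AE) (use ae in auto)
  then have "quantile M (\<lambda>\<omega>. \<bar>f \<omega>\<bar>) = quantile M (\<lambda>\<omega>. \<bar>g \<omega>\<bar>)"
    by (simp add: quantile_def fun_eq_iff)
  then show ?thesis
    by (simp add: rho_def)
qed

lemma spectral_norm_class:
  assumes "f \<in> borel_measurable M"
  shows "spectral_norm M \<sigma> (as_eq M `` {f}) = rho M \<sigma> (\<lambda>\<omega>. \<bar>f \<omega>\<bar>)"
proof -
  have "as_eq M `` {f} \<noteq> {}"
    using equiv_class_self[OF equiv_as_eq assms] by blast
  moreover have "rho M \<sigma> (\<lambda>\<omega>. \<bar>h \<omega>\<bar>) = rho M \<sigma> (\<lambda>\<omega>. \<bar>f \<omega>\<bar>)" if "h \<in> as_eq M `` {f}" for h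
    using that rho_cong_AE[of f h M \<sigma>] by simp
  ultimately show ?thesis
    unfolding spectral_norm_def by (rule the_elem_image_unique)
qed

end

theory Submission
  imports Defs
begin

text \<open>
  The integral of the quantile function of a nonnegative random variable \<open>Y\<close> over a nonempty
  upper interval \<open>U\<close> of \<open>(0,1)\<close> is the minimum of \<open>s * |U| + E (Y - s)\<^sup>+\<close> over \<open>s \<ge> 0\<close>
  (the formula of Rockafellar and Uryasev): \<open>quantile M Y u \<le> s + (quantile M Y u - s)\<^sup>+\<close>
  gives an inequality for every \<open>s\<close>, and it is an equality when \<open>s\<close> separates the
  quantiles over \<open>U\<close> from those below \<open>U\<close>. Positive parts are subadditive, hence so is the
  tail integral as a function of \<open>Y\<close>. The uniform variable \<open>u\<close> lives on \<open>(0,1)\<close> and not on the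
  original probability space, which may have atoms and then carries no such variable.

  A nondecreasing \<open>\<sigma>\<close> is a mixture of indicators of upper intervals: by Fubini,
  \<open>\<integral> \<sigma> * q = \<integral>\<^sub>0\<^sup>\<infinity> (\<integral>\<^bsub>{\<sigma> > t}\<^esub> q) dt\<close>. So the triangle inequality for the spectral norm follows from
  the one for tail integrals (\<open>seminorm_add_le\<close>). The Rockafellar-Uryasev formula also
  shows that a tail integral is at least \<open>E Y * |U|\<close>, and integrating over \<open>t\<close> gives \<open>E |Y| \<le> \<parallel>Y\<parallel>\<close>
  (\<open>nn_integral_abs_le_seminorm\<close>), which makes the norm definite on classes.

  Completeness is the argument of Riesz and Fischer. A Cauchy sequence has a subsequence with
  summable increments, first in the spectral norm and therefore in the mean, so that it
  converges almost surely. Quantiles are lower semicontinuous under almost sure convergence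
  (\<open>quantile_le_liminf\<close>), so the spectral norm satisfies Fatou's lemma
  (\<open>seminorm_Fatou\<close>), and this turns the Cauchy condition into norm convergence to the
  almost sure limit.
\<close>

section \<open>Quantiles\<close>

abbreviation unif :: "real measure" where
  "unif \<equiv> restrict_space lborel {0<..<1}"

lemma ennreal_add_le: "ennreal (a + b) \<le> ennreal a + ennreal b"
proof -
  have "ennreal (a + b) \<le> ennreal (max 0 a + max 0 b)"
    by (intro ennreal_leI) auto
  also have "\<dots> = ennreal a + ennreal b"
    by (simp add: max_def ennreal_neg)
  finally show ?thesis .
qed

lemma prob_space_unif: "prob_space unif"
  by (auto simp: emeasure_restrict_space space_restrict_space intro!: prob_spaceI)

context prob_space
begin

text \<open>
  Identifies \<^const>\<open>quantile\<close> with the generalised inverse of a distribution function that the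
  proof of Skorohod's theorem uses, so that its properties carry over.
\<close>

lemma quantile_eq_pseudoinverse:
  assumes "Y \<in> borel_measurable M"
  shows "quantile M Y = (\<lambda>u. Inf {x. u \<le> cdf (distr M borel Y) x})"
  using assms
  by (simp add: quantile_def cdf_def measure_distr fun_eq_iff vimage_def Int_def conj_commute)

lemma cdf_distribution_distr:
  assumes "Y \<in> borel_measurable M"
  shows "cdf_distribution (distr M borel Y)"
  unfolding cdf_distribution_def using assms by (rule real_distribution_distr)

text \<open>
  The Galois connection between quantiles and the distribution function. It determines the
  quantile, so monotonicity and homogeneity below are read off from distribution functions.
\<close>

lemma quantile_le_iff:
  assumes [measurable]: "Y \<in> borel_measurable M" and u: "0 < u" "u < 1"
  shows "quantile M Y u \<le> y \<longleftrightarrow> u \<le> \<P>(\<omega> in M. Y \<omega> \<le> y)"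
proof -
  interpret D: cdf_distribution "distr M borel Y"
    by (rule cdf_distribution_distr) fact
  have "cdf (distr M borel Y) y = \<P>(\<omega> in M. Y \<omega> \<le> y)"
    by (auto simp: cdf_def measure_distr intro!: arg_cong[where f=prob])
  then show ?thesis
    using D.pseudoinverse[OF u, of y] by (simp add: quantile_eq_pseudoinverse)
qed

lemma less_quantile_iff:
  assumes [measurable]: "Y \<in> borel_measurable M" and u: "0 < u" "u < 1"
  shows "y < quantile M Y u \<longleftrightarrow> 1 - u < \<P>(\<omega> in M. y < Y \<omega>)"
proof -
  have "\<P>(\<omega> in M. y < Y \<omega>) = 1 - \<P>(\<omega> in M. Y \<omega> \<le> y)"
    using prob_neg[of "\<lambda>\<omega>. Y \<omega> \<le> y"] by (simp add: not_le)
  then show ?thesis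
    using quantile_le_iff[OF assms, of y] by auto
qed

lemma quantile_eqI:
  assumes "\<And>y. x \<le> y \<longleftrightarrow> u \<le> \<P>(\<omega> in M. Y \<omega> \<le> y)"
    and "Y \<in> borel_measurable M" "0 < u" "u < 1"
  shows "quantile M Y u = x"
  using assms quantile_le_iff[OF assms(2-4)] by (metis order_antisym order_refl)

lemma mono_on_quantile:
  assumes "Y \<in> borel_measurable M"
  shows "mono_on {0<..<1} (quantile M Y)"
proof -
  interpret D: cdf_distribution "distr M borel Y"
    by (rule cdf_distribution_distr) fact
  show ?thesis
    using D.mono_I assms by (simp add: quantile_eq_pseudoinverse)
qed

lemma measurable_quantile [measurable]:
  assumes "Y \<in> borel_measurable M"
  shows "quantile M Y \<in> borel_measurable unif"
proof -
  have "quantile M Y \<in> borel_measurable (restrict_space borel {0<..<1})"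
    by (intro borel_measurable_mono_on_fnc mono_on_quantile assms)
  then show ?thesis
    by (simp cong: measurable_cong_sets sets_restrict_space_cong)
qed

text \<open>
  Under the uniform distribution the quantile function has the same law as \<open>Y\<close>.
\<close>

lemma nn_integral_quantile:
  assumes [measurable]: "Y \<in> borel_measurable M" "h \<in> borel_measurable borel"
  shows "(\<integral>\<^sup>+u. h (quantile M Y u) \<partial>unif) = (\<integral>\<^sup>+\<omega>. h (Y \<omega>) \<partial>M)"
proof -
  interpret D: cdf_distribution "distr M borel Y"
    by (rule cdf_distribution_distr) fact
  have "(\<integral>\<^sup>+u. h (quantile M Y u) \<partial>unif) = (\<integral>\<^sup>+y. h y \<partial>distr unif borel (quantile M Y))"
    by (simp add: nn_integral_distr)
  also have "distr unif borel (quantile M Y) = distr M borel Y"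
    using D.distr_I_eq_M by (simp add: quantile_eq_pseudoinverse)
  also have "(\<integral>\<^sup>+y. h y \<partial>distr M borel Y) = (\<integral>\<^sup>+\<omega>. h (Y \<omega>) \<partial>M)"
    by (simp add: nn_integral_distr)
  finally show ?thesis .
qed

lemma quantile_mono:
  assumes [measurable]: "Y \<in> borel_measurable M" "Z \<in> borel_measurable M"
    and le: "AE \<omega> in M. Y \<omega> \<le> Z \<omega>" and u: "0 < u" "u < 1"
  shows "quantile M Y u \<le> quantile M Z u"
proof -
  have "u \<le> \<P>(\<omega> in M. Z \<omega> \<le> quantile M Z u)"
    using quantile_le_iff[of Z u "quantile M Z u"] u by simp
  also have "\<dots> \<le> \<P>(\<omega> in M. Y \<omega> \<le> quantile M Z u)"
    using le by (intro finite_measure_mono_AE) auto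
  finally show ?thesis
    using quantile_le_iff[of Y u] u by simp
qed

lemma quantile_cmult:
  assumes [measurable]: "Y \<in> borel_measurable M" and c: "0 \<le> c" and u: "0 < u" "u < 1"
  shows "quantile M (\<lambda>\<omega>. c * Y \<omega>) u = c * quantile M Y u"
proof (rule quantile_eqI)
  fix y
  show "c * quantile M Y u \<le> y \<longleftrightarrow> u \<le> \<P>(\<omega> in M. c * Y \<omega> \<le> y)"
  proof (cases "c = 0")
    case True
    then show ?thesis using u prob_space by (cases "0 \<le> y") auto
  next
    case False
    with c have "c * x \<le> y \<longleftrightarrow> x \<le> y / c" for x
      by (simp add: field_simps)
    then show ?thesis
      using quantile_le_iff[of Y u "y / c"] u by simp
  qed
qed (use u in auto)

lemma quantile_nonneg:
  assumes [measurable]: "Y \<in> borel_measurable M" and pos: "AE \<omega> in M. 0 \<le> Y \<omega>" and u: "0 < u" "u < 1"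
  shows "0 \<le> quantile M Y u"
  using quantile_mono[of "\<lambda>\<omega>. 0 * Y \<omega>" Y u] quantile_cmult[of Y 0 u] pos u by simp

text \<open>
  If \<open>c < quantile M Z u\<close>, then \<open>P (Z > c) > 1 - u\<close>. The indicators of the open sets
  \<open>{Y n > c}\<close> are eventually 1 wherever \<open>Z > c\<close>, so Fatou's lemma for integrals gives
  \<open>P (Y n > c) > 1 - u\<close> for large \<open>n\<close>, that is, \<open>c < quantile M (Y n) u\<close>.
\<close>

lemma quantile_le_liminf:
  fixes Y :: "nat \<Rightarrow> 'a \<Rightarrow> real"
  assumes [measurable]: "\<And>n. Y n \<in> borel_measurable M" "Z \<in> borel_measurable M"
    and lim: "AE \<omega> in M. (\<lambda>n. Y n \<omega>) \<longlonglongrightarrow> Z \<omega>" and u: "0 < u" "u < 1"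
  shows "ennreal (quantile M Z u) \<le> liminf (\<lambda>n. ennreal (quantile M (Y n) u))"
  unfolding le_Liminf_iff
proof (intro allI impI)
  fix y assume "y < ennreal (quantile M Z u)"
  then obtain c where c: "0 \<le> c" "y = ennreal c" "c < quantile M Z u"
    by (cases y) (auto simp: ennreal_less_iff)
  let ?p = "\<lambda>X. \<integral>\<^sup>+\<omega>. indicator {c<..} (X \<omega>) \<partial>M"
  have p: "?p X = ennreal \<P>(\<omega> in M. c < X \<omega>)" if [measurable]: "X \<in> borel_measurable M" for X
  proof -
    have "?p X = (\<integral>\<^sup>+\<omega>. indicator {\<omega>\<in>space M. c < X \<omega>} \<omega> \<partial>M)"
      by (intro nn_integral_cong) (auto simp: indicator_def)
    also have "\<dots> = ennreal \<P>(\<omega> in M. c < X \<omega>)"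
      by (simp add: emeasure_eq_measure)
    finally show ?thesis .
  qed
  have "ennreal (1 - u) < ?p Z"
    using c u less_quantile_iff[of Z u c] by (simp add: p ennreal_less_iff)
  also have "?p Z \<le> (\<integral>\<^sup>+\<omega>. liminf (\<lambda>n. indicator {c<..} (Y n \<omega>)) \<partial>M)"
  proof (intro nn_integral_mono_AE)
    show "AE \<omega> in M. indicator {c<..} (Z \<omega>) \<le> liminf (\<lambda>n. indicator {c<..} (Y n \<omega>) :: ennreal)"
      using lim
    proof eventually_elim
      fix \<omega> assume *: "(\<lambda>n. Y n \<omega>) \<longlonglongrightarrow> Z \<omega>"
      show "indicator {c<..} (Z \<omega>) \<le> liminf (\<lambda>n. indicator {c<..} (Y n \<omega>) :: ennreal)"
      proof (cases "c < Z \<omega>")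
        case True
        have "\<forall>\<^sub>F n in sequentially. 1 \<le> (indicator {c<..} (Y n \<omega>) :: ennreal)"
          using order_tendstoD(1)[OF * True] by eventually_elim simp
        then show ?thesis
          using True by (auto intro: Liminf_bounded)
      qed simp
    qed
  qed
  also have "\<dots> \<le> liminf (\<lambda>n. ?p (Y n))"
    by (rule nn_integral_liminf) measurable
  finally have "\<forall>\<^sub>F n in sequentially. ennreal (1 - u) < ?p (Y n)"
    by (rule less_LiminfD)
  then show "\<forall>\<^sub>F n in sequentially. y < ennreal (quantile M (Y n) u)"
  proof eventually_elim
    fix n assume "ennreal (1 - u) < ?p (Y n)"
    then have "c < quantile M (Y n) u"
      using u less_quantile_iff[of "Y n" u c] by (simp add: p ennreal_less_iff)
    with c show "y < ennreal (quantile M (Y n) u)"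
      by (simp add: ennreal_less_iff)
  qed
qed

end

section \<open>Tail integrals of quantiles\<close>

context prob_space
begin

text \<open>
  The easy half of the Rockafellar-Uryasev formula: every threshold \<open>s\<close> gives an upper bound,
  because \<open>q \<le> s + (q - s)\<^sup>+\<close> and \<open>(q - s)\<^sup>+\<close> may be integrated over the whole interval.
\<close>

lemma tail_integral_quantile_le:
  assumes [measurable]: "Y \<in> borel_measurable M" and U [measurable]: "U \<in> sets unif" and s: "0 \<le> s"
  shows "(\<integral>\<^sup>+u\<in>U. ennreal (quantile M Y u) \<partial>unif) \<le>
    ennreal s * emeasure unif U + (\<integral>\<^sup>+\<omega>. ennreal (Y \<omega> - s) \<partial>M)"
proof -
  have "(\<integral>\<^sup>+u\<in>U. ennreal (quantile M Y u) \<partial>unif) \<le>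
      (\<integral>\<^sup>+u. ennreal s * indicator U u + ennreal (quantile M Y u - s) \<partial>unif)"
  proof (intro nn_integral_mono)
    fix u
    show "ennreal (quantile M Y u) * indicator U u \<le>
        ennreal s * indicator U u + ennreal (quantile M Y u - s)"
      using ennreal_add_le[of s "quantile M Y u - s"] by (simp add: indicator_def)
  qed
  also have "\<dots> = ennreal s * emeasure unif U + (\<integral>\<^sup>+u. ennreal (quantile M Y u - s) \<partial>unif)"
    by (simp add: nn_integral_add nn_integral_cmult_indicator)
  also have "(\<integral>\<^sup>+u. ennreal (quantile M Y u - s) \<partial>unif) = (\<integral>\<^sup>+\<omega>. ennreal (Y \<omega> - s) \<partial>M)"
    by (rule nn_integral_quantile) auto
  finally show ?thesis .
qed

text \<open>
  The bound is attained at the infimum \<open>s\<close> of the quantiles over \<open>U\<close>. Quantiles off \<open>U\<close> are at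
  most \<open>s\<close> since \<open>U\<close> is upward closed, so \<open>(q - s)\<^sup>+\<close> vanishes there and nothing is lost.
\<close>

lemma tail_integral_quantile_eq:
  assumes Y [measurable]: "Y \<in> borel_measurable M" and pos: "AE \<omega> in M. 0 \<le> Y \<omega>"
    and U [measurable]: "U \<in> sets unif" and ne: "U \<noteq> {}"
    and up: "\<And>u v. u \<in> U \<Longrightarrow> u \<le> v \<Longrightarrow> v < 1 \<Longrightarrow> v \<in> U"
  obtains s where "0 \<le> s" "(\<integral>\<^sup>+u\<in>U. ennreal (quantile M Y u) \<partial>unif) =
    ennreal s * emeasure unif U + (\<integral>\<^sup>+\<omega>. ennreal (Y \<omega> - s) \<partial>M)"
proof
  have sub: "U \<subseteq> {0<..<1}"
    using sets.sets_into_space[OF U] by (simp add: space_restrict_space)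
  define s where "s = Inf (quantile M Y ` U)"
  have q0: "0 \<le> quantile M Y u" if "u \<in> {0<..<1}" for u
    using quantile_nonneg[OF Y pos] that by simp
  show s0: "0 \<le> s"
    unfolding s_def using ne q0 sub by (intro cINF_greatest) auto
  have in_U: "s \<le> quantile M Y u" if "u \<in> U" for u
    unfolding s_def using that q0 sub by (intro cINF_lower bdd_belowI[of _ 0]) auto
  have not_U: "quantile M Y u \<le> s" if u: "u \<in> {0<..<1}" "u \<notin> U" for u
    unfolding s_def
  proof (intro cINF_greatest ne)
    fix v assume v: "v \<in> U"
    have "u \<le> v" using up[OF v, of u] u by force
    then show "quantile M Y u \<le> quantile M Y v"
      using mono_onD[OF mono_on_quantile[OF Y]] u v sub by blast
  qed
  have "(\<integral>\<^sup>+u\<in>U. ennreal (quantile M Y u) \<partial>unif) =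
      (\<integral>\<^sup>+u. ennreal s * indicator U u + ennreal (quantile M Y u - s) \<partial>unif)"
  proof (intro nn_integral_cong)
    fix u assume "u \<in> space unif"
    then have u: "u \<in> {0<..<1}" by (simp add: space_restrict_space)
    show "ennreal (quantile M Y u) * indicator U u =
        ennreal s * indicator U u + ennreal (quantile M Y u - s)"
    proof (cases "u \<in> U")
      case True
      with in_U[OF this] s0 show ?thesis
        by (simp add: ennreal_plus[symmetric] del: ennreal_plus)
    next
      case False
      with not_U[OF u] show ?thesis by (simp add: ennreal_neg)
    qed
  qed
  also have "\<dots> = ennreal s * emeasure unif U + (\<integral>\<^sup>+u. ennreal (quantile M Y u - s) \<partial>unif)"
    by (simp add: nn_integral_add nn_integral_cmult_indicator)
  also have "(\<integral>\<^sup>+u. ennreal (quantile M Y u - s) \<partial>unif) = (\<integral>\<^sup>+\<omega>. ennreal (Y \<omega> - s) \<partial>M)"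
    by (rule nn_integral_quantile) auto
  finally show "(\<integral>\<^sup>+u\<in>U. ennreal (quantile M Y u) \<partial>unif) =
    ennreal s * emeasure unif U + (\<integral>\<^sup>+\<omega>. ennreal (Y \<omega> - s) \<partial>M)" .
qed

text \<open>
  Optimal thresholds \<open>s\<close> for \<open>Y\<close> and \<open>t\<close> for \<open>Z\<close> make \<open>s + t\<close> an admissible threshold for the
  sum, and \<open>(Y + Z - (s + t))\<^sup>+ \<le> (Y - s)\<^sup>+ + (Z - t)\<^sup>+\<close>.
\<close>

lemma tail_integral_quantile_add_le:
  assumes Y [measurable]: "Y \<in> borel_measurable M" and Y0: "AE \<omega> in M. 0 \<le> Y \<omega>"
    and Z [measurable]: "Z \<in> borel_measurable M" and Z0: "AE \<omega> in M. 0 \<le> Z \<omega>"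
    and U [measurable]: "U \<in> sets unif"
    and up: "\<And>u v. u \<in> U \<Longrightarrow> u \<le> v \<Longrightarrow> v < 1 \<Longrightarrow> v \<in> U"
  shows "(\<integral>\<^sup>+u\<in>U. ennreal (quantile M (\<lambda>\<omega>. Y \<omega> + Z \<omega>) u) \<partial>unif) \<le>
    (\<integral>\<^sup>+u\<in>U. ennreal (quantile M Y u) \<partial>unif) + (\<integral>\<^sup>+u\<in>U. ennreal (quantile M Z u) \<partial>unif)"
proof (cases "U = {}")
  case False
  obtain s where s: "0 \<le> s" "(\<integral>\<^sup>+u\<in>U. ennreal (quantile M Y u) \<partial>unif) =
      ennreal s * emeasure unif U + (\<integral>\<^sup>+\<omega>. ennreal (Y \<omega> - s) \<partial>M)"
    by (rule tail_integral_quantile_eq[OF Y Y0 U False]) (assumption | rule up)+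
  obtain t where t: "0 \<le> t" "(\<integral>\<^sup>+u\<in>U. ennreal (quantile M Z u) \<partial>unif) =
      ennreal t * emeasure unif U + (\<integral>\<^sup>+\<omega>. ennreal (Z \<omega> - t) \<partial>M)"
    by (rule tail_integral_quantile_eq[OF Z Z0 U False]) (assumption | rule up)+
  have "(\<integral>\<^sup>+u\<in>U. ennreal (quantile M (\<lambda>\<omega>. Y \<omega> + Z \<omega>) u) \<partial>unif) \<le>
      ennreal (s + t) * emeasure unif U + (\<integral>\<^sup>+\<omega>. ennreal (Y \<omega> + Z \<omega> - (s + t)) \<partial>M)"
    using s t by (intro tail_integral_quantile_le) auto
  also have "(\<integral>\<^sup>+\<omega>. ennreal (Y \<omega> + Z \<omega> - (s + t)) \<partial>M) \<le>
      (\<integral>\<^sup>+\<omega>. ennreal (Y \<omega> - s) + ennreal (Z \<omega> - t) \<partial>M)"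
  proof (intro nn_integral_mono)
    fix \<omega>
    show "ennreal (Y \<omega> + Z \<omega> - (s + t)) \<le> ennreal (Y \<omega> - s) + ennreal (Z \<omega> - t)"
      using ennreal_add_le[of "Y \<omega> - s" "Z \<omega> - t"] by (simp add: algebra_simps)
  qed
  also have "\<dots> = (\<integral>\<^sup>+\<omega>. ennreal (Y \<omega> - s) \<partial>M) + (\<integral>\<^sup>+\<omega>. ennreal (Z \<omega> - t) \<partial>M)"
    by (rule nn_integral_add) auto
  finally have "(\<integral>\<^sup>+u\<in>U. ennreal (quantile M (\<lambda>\<omega>. Y \<omega> + Z \<omega>) u) \<partial>unif) \<le>
      ennreal (s + t) * emeasure unif U +
      ((\<integral>\<^sup>+\<omega>. ennreal (Y \<omega> - s) \<partial>M) + (\<integral>\<^sup>+\<omega>. ennreal (Z \<omega> - t) \<partial>M))"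
    by (simp add: add_left_mono)
  also have "\<dots> = (ennreal s * emeasure unif U + (\<integral>\<^sup>+\<omega>. ennreal (Y \<omega> - s) \<partial>M)) +
      (ennreal t * emeasure unif U + (\<integral>\<^sup>+\<omega>. ennreal (Z \<omega> - t) \<partial>M))"
    using s(1) t(1) by (simp add: distrib_right ac_simps)
  finally show ?thesis
    by (simp only: s(2) t(2))
qed simp

text \<open>
  With the optimal threshold \<open>s\<close> and \<open>|U| \<le> 1\<close>, the tail integral is at least
  \<open>|U| * (s + E (Y - s)\<^sup>+)\<close>, and \<open>s + (Y - s)\<^sup>+ \<ge> Y\<close>.
\<close>

lemma expectation_le_tail_integral_quantile:
  assumes Y [measurable]: "Y \<in> borel_measurable M" and Y0: "AE \<omega> in M. 0 \<le> Y \<omega>"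
    and U [measurable]: "U \<in> sets unif"
    and up: "\<And>u v. u \<in> U \<Longrightarrow> u \<le> v \<Longrightarrow> v < 1 \<Longrightarrow> v \<in> U"
  shows "(\<integral>\<^sup>+\<omega>. ennreal (Y \<omega>) \<partial>M) * emeasure unif U \<le> (\<integral>\<^sup>+u\<in>U. ennreal (quantile M Y u) \<partial>unif)"
proof (cases "U = {}")
  case False
  interpret unif: prob_space unif by (rule prob_space_unif)
  obtain s where s: "0 \<le> s" "(\<integral>\<^sup>+u\<in>U. ennreal (quantile M Y u) \<partial>unif) =
      ennreal s * emeasure unif U + (\<integral>\<^sup>+\<omega>. ennreal (Y \<omega> - s) \<partial>M)"
    by (rule tail_integral_quantile_eq[OF Y Y0 U False]) (assumption | rule up)+
  have "(\<integral>\<^sup>+\<omega>. ennreal (Y \<omega>) \<partial>M) \<le> (\<integral>\<^sup>+\<omega>. ennreal s + ennreal (Y \<omega> - s) \<partial>M)"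
  proof (intro nn_integral_mono)
    fix \<omega>
    show "ennreal (Y \<omega>) \<le> ennreal s + ennreal (Y \<omega> - s)"
      using ennreal_add_le[of s "Y \<omega> - s"] by simp
  qed
  also have "\<dots> = ennreal s + (\<integral>\<^sup>+\<omega>. ennreal (Y \<omega> - s) \<partial>M)"
    by (simp add: nn_integral_add emeasure_space_1)
  finally have "(\<integral>\<^sup>+\<omega>. ennreal (Y \<omega>) \<partial>M) * emeasure unif U \<le>
      (ennreal s + (\<integral>\<^sup>+\<omega>. ennreal (Y \<omega> - s) \<partial>M)) * emeasure unif U"
    by (rule mult_right_mono) simp
  also have "\<dots> \<le> ennreal s * emeasure unif U + (\<integral>\<^sup>+\<omega>. ennreal (Y \<omega> - s) \<partial>M) * 1"
    unfolding distrib_right by (intro add_left_mono mult_left_mono) (auto simp: unif.emeasure_le_1)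
  finally show ?thesis
    using s by simp
qed simp

end

section \<open>The spectral seminorm of a random variable\<close>

text \<open>
  Write \<open>s x\<close> as the length of \<open>[0, s x)\<close> and exchange the integrals.
\<close>

lemma (in sigma_finite_measure) nn_integral_mult_layer_cake:
  fixes s :: "'a \<Rightarrow> real"
  assumes [measurable]: "s \<in> borel_measurable M" "h \<in> borel_measurable M"
  shows "(\<integral>\<^sup>+x. ennreal (s x) * h x \<partial>M) = (\<integral>\<^sup>+t\<in>{0..}. (\<integral>\<^sup>+x\<in>{x. t < s x}. h x \<partial>M) \<partial>lborel)"
proof -
  interpret P: pair_sigma_finite M lborel ..
  have "(\<integral>\<^sup>+x. ennreal (s x) * h x \<partial>M) =
      (\<integral>\<^sup>+x. (\<integral>\<^sup>+t. h x * (if 0 \<le> t \<and> t < s x then 1 else 0) \<partial>lborel) \<partial>M)"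
  proof (intro nn_integral_cong)
    fix x
    have "ennreal (s x) = emeasure lborel {0..<s x}"
      by (cases "0 \<le> s x") (auto simp: ennreal_neg)
    also have "\<dots> = (\<integral>\<^sup>+t. indicator {0..<s x} t \<partial>lborel)"
      by simp
    also have "\<dots> = (\<integral>\<^sup>+t. (if 0 \<le> t \<and> t < s x then 1 else 0) \<partial>lborel)"
      by (intro nn_integral_cong) (auto simp: indicator_def)
    finally show "ennreal (s x) * h x = (\<integral>\<^sup>+t. h x * (if 0 \<le> t \<and> t < s x then 1 else 0) \<partial>lborel)"
      by (simp add: nn_integral_cmult mult.commute)
  qed
  also have "\<dots> = (\<integral>\<^sup>+t. (\<integral>\<^sup>+x. h x * (if 0 \<le> t \<and> t < s x then 1 else 0) \<partial>M) \<partial>lborel)"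
    by (rule P.Fubini'[symmetric]) measurable
  also have "\<dots> = (\<integral>\<^sup>+t\<in>{0..}. (\<integral>\<^sup>+x\<in>{x. t < s x}. h x \<partial>M) \<partial>lborel)"
    by (intro nn_integral_cong) (auto simp: indicator_def intro!: nn_integral_cong)
  finally show ?thesis .
qed

text \<open>
  The spectral norm as a functional of functions with values in \<open>[0,\<infinity>]\<close>, where integrals are
  total; it agrees with \<^const>\<open>spectral_norm\<close> by \<open>spectral_norm_cls\<close> below.
\<close>

definition spectral_seminorm :: "'a measure \<Rightarrow> (real \<Rightarrow> real) \<Rightarrow> ('a \<Rightarrow> real) \<Rightarrow> ennreal" where
  "spectral_seminorm M \<sigma> f = (\<integral>\<^sup>+u. ennreal (\<sigma> u) * ennreal (quantile M (\<lambda>\<omega>. \<bar>f \<omega>\<bar>) u) \<partial>unif)"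

locale spectral_prob_space = prob_space M for M :: "'a measure" +
  fixes \<sigma> :: "real \<Rightarrow> real"
  assumes spectral: "spectral_function \<sigma>"
begin

abbreviation N :: "('a \<Rightarrow> real) \<Rightarrow> ennreal" where
  "N \<equiv> spectral_seminorm M \<sigma>"

lemma mono_on_spectral: "mono_on {0<..<1} \<sigma>"
  using spectral by (auto simp: spectral_function_def intro: mono_on_subset)

lemma spectral_nonneg: "u \<in> {0<..<1} \<Longrightarrow> 0 \<le> \<sigma> u"
  using spectral by (auto simp: spectral_function_def)

lemma measurable_spectral [measurable]: "\<sigma> \<in> borel_measurable unif"
proof -
  have "\<sigma> \<in> borel_measurable (restrict_space borel {0<..<1})"
    by (intro borel_measurable_mono_on_fnc mono_on_spectral)
  then show ?thesis
    by (simp cong: measurable_cong_sets sets_restrict_space_cong)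
qed

lemma nn_integral_spectral: "(\<integral>\<^sup>+u. ennreal (\<sigma> u) \<partial>unif) = 1"
proof -
  have "(\<integral>\<^sup>+u. ennreal (\<sigma> u) \<partial>unif) = (\<integral>\<^sup>+u\<in>{0<..<1}. ennreal (\<sigma> u) \<partial>lborel)"
    by (simp add: nn_integral_restrict_space)
  also have "\<dots> = (\<integral>\<^sup>+u\<in>{0..<1}. ennreal (\<sigma> u) \<partial>lborel)"
    using AE_lborel_singleton[of "0::real"]
    by (intro nn_integral_cong_AE) (auto simp: indicator_def elim!: eventually_mono)
  finally show ?thesis
    using spectral by (simp add: spectral_function_def)
qed

text \<open>
  Monotonicity of \<open>\<sigma>\<close> enters here: the layers of \<open>\<sigma>\<close> are upward closed, which is what the
  Rockafellar-Uryasev formula asks for.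
\<close>

lemma superlevel_spectral:
  shows "{u\<in>{0<..<1}. t < \<sigma> u} \<in> sets unif"
    and "\<And>u v. u \<in> {u\<in>{0<..<1}. t < \<sigma> u} \<Longrightarrow> u \<le> v \<Longrightarrow> v < 1 \<Longrightarrow> v \<in> {u\<in>{0<..<1}. t < \<sigma> u}"
proof -
  have "{u\<in>space unif. t < \<sigma> u} \<in> sets unif"
    by measurable
  then show "{u\<in>{0<..<1}. t < \<sigma> u} \<in> sets unif"
    by (simp add: space_restrict_space)
  fix u v assume *: "u \<in> {u\<in>{0<..<1}. t < \<sigma> u}" "u \<le> v" "v < 1"
  then have "\<sigma> u \<le> \<sigma> v"
    by (intro mono_onD[OF mono_on_spectral]) auto
  with * show "v \<in> {u\<in>{0<..<1}. t < \<sigma> u}"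
    by auto
qed

lemma nn_integral_spectral_layer_cake:
  assumes "h \<in> borel_measurable unif"
  shows "(\<integral>\<^sup>+u. ennreal (\<sigma> u) * h u \<partial>unif) =
    (\<integral>\<^sup>+t\<in>{0..}. (\<integral>\<^sup>+u\<in>{u\<in>{0<..<1}. t < \<sigma> u}. h u \<partial>unif) \<partial>lborel)"
proof -
  interpret unif: prob_space unif by (rule prob_space_unif)
  show ?thesis
    unfolding unif.nn_integral_mult_layer_cake[OF measurable_spectral assms]
    by (auto intro!: nn_integral_cong simp: indicator_def space_restrict_space)
qed

lemma measurable_layer:
  assumes [measurable]: "h \<in> borel_measurable unif"
  shows "(\<lambda>t. (\<integral>\<^sup>+u\<in>{u\<in>{0<..<1}. t < \<sigma> u}. h u \<partial>unif)) \<in> borel_measurable lborel"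
proof -
  interpret unif: prob_space unif by (rule prob_space_unif)
  have "(\<lambda>t. (\<integral>\<^sup>+u. h u * (if t < \<sigma> u then 1 else 0) \<partial>unif)) \<in> borel_measurable lborel"
    by measurable
  also have "(\<lambda>t. (\<integral>\<^sup>+u. h u * (if t < \<sigma> u then 1 else 0) \<partial>unif)) =
      (\<lambda>t. (\<integral>\<^sup>+u\<in>{u\<in>{0<..<1}. t < \<sigma> u}. h u \<partial>unif))"
    by (auto intro!: nn_integral_cong ext simp: indicator_def space_restrict_space)
  finally show ?thesis .
qed

text \<open>
  Layer by layer this is \<open>tail_integral_quantile_add_le\<close>.
\<close>

lemma seminorm_add_le:
  assumes [measurable]: "f \<in> borel_measurable M" "g \<in> borel_measurable M"
  shows "N (\<lambda>\<omega>. f \<omega> + g \<omega>) \<le> N f + N g"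
proof -
  let ?q = "\<lambda>Y u. ennreal (quantile M Y u)"
  let ?T = "\<lambda>h t. \<integral>\<^sup>+u\<in>{u\<in>{0<..<1}. t < \<sigma> u}. h u \<partial>unif"
  have "N (\<lambda>\<omega>. f \<omega> + g \<omega>) \<le> (\<integral>\<^sup>+u. ennreal (\<sigma> u) * ?q (\<lambda>\<omega>. \<bar>f \<omega>\<bar> + \<bar>g \<omega>\<bar>) u \<partial>unif)"
    unfolding spectral_seminorm_def
    by (intro nn_integral_mono mult_left_mono ennreal_leI quantile_mono)
       (auto simp: space_restrict_space)
  also have "\<dots> = (\<integral>\<^sup>+t\<in>{0..}. ?T (?q (\<lambda>\<omega>. \<bar>f \<omega>\<bar> + \<bar>g \<omega>\<bar>)) t \<partial>lborel)"
    by (rule nn_integral_spectral_layer_cake) measurable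
  also have "\<dots> \<le> (\<integral>\<^sup>+t. ?T (?q (\<lambda>\<omega>. \<bar>f \<omega>\<bar>)) t * indicator {0..} t +
      ?T (?q (\<lambda>\<omega>. \<bar>g \<omega>\<bar>)) t * indicator {0..} t \<partial>lborel)"
    unfolding distrib_right[symmetric]
    by (intro nn_integral_mono mult_right_mono tail_integral_quantile_add_le superlevel_spectral(1))
       ((rule superlevel_spectral(2), assumption+) | simp)+
  also have "\<dots> = (\<integral>\<^sup>+t\<in>{0..}. ?T (?q (\<lambda>\<omega>. \<bar>f \<omega>\<bar>)) t \<partial>lborel) +
      (\<integral>\<^sup>+t\<in>{0..}. ?T (?q (\<lambda>\<omega>. \<bar>g \<omega>\<bar>)) t \<partial>lborel)"
    by (intro nn_integral_add borel_measurable_times_ennreal measurable_layer) measurable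
  also have "\<dots> = N f + N g"
    unfolding spectral_seminorm_def
    by (subst (1 2) nn_integral_spectral_layer_cake) measurable
  finally show ?thesis .
qed

text \<open>
  Since \<open>\<sigma>\<close> integrates to 1, the expectation is the integral of \<open>\<sigma>\<close> times a constant. Both sides
  can then be compared on each layer of \<open>\<sigma>\<close>.
\<close>

lemma nn_integral_abs_le_seminorm:
  assumes [measurable]: "f \<in> borel_measurable M"
  shows "(\<integral>\<^sup>+\<omega>. ennreal \<bar>f \<omega>\<bar> \<partial>M) \<le> N f"
proof -
  let ?E = "\<integral>\<^sup>+\<omega>. ennreal \<bar>f \<omega>\<bar> \<partial>M"
  let ?T = "\<lambda>h t. \<integral>\<^sup>+u\<in>{u\<in>{0<..<1}. t < \<sigma> u}. h u \<partial>unif"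
  have "?E = (\<integral>\<^sup>+u. ennreal (\<sigma> u) * ?E \<partial>unif)"
    by (simp add: nn_integral_multc nn_integral_spectral)
  also have "\<dots> = (\<integral>\<^sup>+t\<in>{0..}. ?T (\<lambda>u. ?E) t \<partial>lborel)"
    by (rule nn_integral_spectral_layer_cake) measurable
  also have "\<dots> \<le> (\<integral>\<^sup>+t\<in>{0..}. ?T (\<lambda>u. ennreal (quantile M (\<lambda>\<omega>. \<bar>f \<omega>\<bar>) u)) t \<partial>lborel)"
  proof (rule nn_integral_mono, rule mult_right_mono)
    fix t
    have "?T (\<lambda>u. ?E) t = ?E * emeasure unif {u\<in>{0<..<1}. t < \<sigma> u}"
      by (rule nn_integral_cmult_indicator[OF superlevel_spectral(1)])
    also have "\<dots> \<le> ?T (\<lambda>u. ennreal (quantile M (\<lambda>\<omega>. \<bar>f \<omega>\<bar>) u)) t"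
      by (intro expectation_le_tail_integral_quantile superlevel_spectral(1))
         ((rule superlevel_spectral(2), assumption+) | simp)+
    finally show "?T (\<lambda>u. ?E) t \<le> ?T (\<lambda>u. ennreal (quantile M (\<lambda>\<omega>. \<bar>f \<omega>\<bar>) u)) t" .
  qed simp
  also have "\<dots> = N f"
    unfolding spectral_seminorm_def
    by (rule nn_integral_spectral_layer_cake[symmetric]) measurable
  finally show ?thesis .
qed

lemma seminorm_cmult:
  assumes [measurable]: "f \<in> borel_measurable M"
  shows "N (\<lambda>\<omega>. c * f \<omega>) = ennreal \<bar>c\<bar> * N f"
proof -
  have "N (\<lambda>\<omega>. c * f \<omega>) =
      (\<integral>\<^sup>+u. ennreal \<bar>c\<bar> * (ennreal (\<sigma> u) * ennreal (quantile M (\<lambda>\<omega>. \<bar>f \<omega>\<bar>) u)) \<partial>unif)"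
    unfolding spectral_seminorm_def
    by (intro nn_integral_cong)
       (simp add: space_restrict_space abs_mult quantile_cmult ennreal_mult' quantile_nonneg ac_simps)
  also have "\<dots> = ennreal \<bar>c\<bar> * N f"
    unfolding spectral_seminorm_def by (rule nn_integral_cmult) measurable
  finally show ?thesis .
qed

lemma seminorm_eq_0_iff:
  assumes [measurable]: "f \<in> borel_measurable M"
  shows "N f = 0 \<longleftrightarrow> (AE \<omega> in M. f \<omega> = 0)"
proof
  assume "N f = 0"
  then have "(\<integral>\<^sup>+\<omega>. ennreal \<bar>f \<omega>\<bar> \<partial>M) = 0"
    using nn_integral_abs_le_seminorm[of f] by simp
  then show "AE \<omega> in M. f \<omega> = 0"
    by (simp add: nn_integral_0_iff_AE)
next
  assume 0: "AE \<omega> in M. f \<omega> = 0"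
  have "quantile M (\<lambda>\<omega>. \<bar>f \<omega>\<bar>) u \<le> 0" if "0 < u" "u < 1" for u
    using quantile_mono[of "\<lambda>\<omega>. \<bar>f \<omega>\<bar>" "\<lambda>\<omega>. 0 * f \<omega>" u] quantile_cmult[of f 0 u] 0 that
    by (auto elim!: eventually_mono)
  then show "N f = 0"
    unfolding spectral_seminorm_def
    by (subst nn_integral_0_iff_AE) (auto simp: space_restrict_space ennreal_neg intro!: AE_I2)
qed

text \<open>
  Fatou's lemma for integrals, applied to the lower semicontinuity of each quantile.
\<close>

lemma seminorm_Fatou:
  fixes f :: "nat \<Rightarrow> 'a \<Rightarrow> real"
  assumes [measurable]: "\<And>n. f n \<in> borel_measurable M" "g \<in> borel_measurable M"
    and lim: "AE \<omega> in M. (\<lambda>n. f n \<omega>) \<longlonglongrightarrow> g \<omega>"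
  shows "N g \<le> liminf (\<lambda>n. N (f n))"
proof -
  let ?q = "\<lambda>f u. ennreal (quantile M (\<lambda>\<omega>. \<bar>f \<omega>\<bar>) u)"
  have "N g \<le> (\<integral>\<^sup>+u. liminf (\<lambda>n. ennreal (\<sigma> u) * ?q (f n) u) \<partial>unif)"
    unfolding spectral_seminorm_def
  proof (intro nn_integral_mono)
    fix u assume "u \<in> space unif"
    then have u: "0 < u" "u < 1"
      by (auto simp: space_restrict_space)
    have "?q g u \<le> liminf (\<lambda>n. ?q (f n) u)"
      by (rule quantile_le_liminf[OF _ _ _ u]) (use lim in \<open>auto elim!: eventually_mono intro: tendsto_rabs\<close>)
    then have "ennreal (\<sigma> u) * ?q g u \<le> ennreal (\<sigma> u) * liminf (\<lambda>n. ?q (f n) u)"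
      by (rule mult_left_mono) simp
    also have "\<dots> = liminf (\<lambda>n. ennreal (\<sigma> u) * ?q (f n) u)"
      by (rule Liminf_compose_continuous_mono[symmetric])
         (auto intro!: ennreal_continuous_on_cmult continuous_on_id monoI mult_left_mono)
    finally show "ennreal (\<sigma> u) * ?q g u \<le> liminf (\<lambda>n. ennreal (\<sigma> u) * ?q (f n) u)" .
  qed
  also have "\<dots> \<le> liminf (\<lambda>n. N (f n))"
    unfolding spectral_seminorm_def by (rule nn_integral_liminf) measurable
  finally show ?thesis .
qed

text \<open>
  The spectral norm dominates the mean, so the sum of the absolute increments has a finite
  expectation and is therefore finite almost surely.
\<close>

lemma AE_convergent_if_summable_seminorm:
  fixes f :: "nat \<Rightarrow> 'a \<Rightarrow> real"
  assumes [measurable]: "\<And>n. f n \<in> borel_measurable M"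
    and fin: "(\<Sum>n. N (\<lambda>\<omega>. f (Suc n) \<omega> - f n \<omega>)) < \<infinity>"
  shows "AE \<omega> in M. convergent (\<lambda>n. f n \<omega>)"
proof -
  have "(\<integral>\<^sup>+\<omega>. (\<Sum>n. ennreal \<bar>f (Suc n) \<omega> - f n \<omega>\<bar>) \<partial>M) =
      (\<Sum>n. \<integral>\<^sup>+\<omega>. ennreal \<bar>f (Suc n) \<omega> - f n \<omega>\<bar> \<partial>M)"
    by (rule nn_integral_suminf) measurable
  also have "\<dots> \<le> (\<Sum>n. N (\<lambda>\<omega>. f (Suc n) \<omega> - f n \<omega>))"
    by (intro suminf_le nn_integral_abs_le_seminorm) auto
  finally have "(\<integral>\<^sup>+\<omega>. (\<Sum>n. ennreal \<bar>f (Suc n) \<omega> - f n \<omega>\<bar>) \<partial>M) \<noteq> \<infinity>"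
    using fin by auto
  then have "AE \<omega> in M. (\<Sum>n. ennreal \<bar>f (Suc n) \<omega> - f n \<omega>\<bar>) \<noteq> \<infinity>"
    by (intro nn_integral_PInf_AE) auto
  then show ?thesis
  proof eventually_elim
    fix \<omega> assume "(\<Sum>n. ennreal \<bar>f (Suc n) \<omega> - f n \<omega>\<bar>) \<noteq> \<infinity>"
    then have "summable (\<lambda>n. \<bar>f (Suc n) \<omega> - f n \<omega>\<bar>)"
      by (intro summable_suminf_not_top) auto
    then have "summable (\<lambda>n. f (Suc n) \<omega> - f n \<omega>)"
      by (rule summable_rabs_cancel)
    then have "convergent (\<lambda>n. \<Sum>i<n. f (Suc i) \<omega> - f i \<omega>)"
      by (simp add: summable_iff_convergent)
    then have "convergent (\<lambda>n. f n \<omega> - f 0 \<omega>)"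
      by (simp add: sum_lessThan_telescope[of "\<lambda>i. f i \<omega>"])
    then show "convergent (\<lambda>n. f n \<omega>)"
      using convergent_add[OF _ convergent_const[of "f 0 \<omega>"]] by fastforce
  qed
qed

text \<open>
  The limit is the almost sure limit of a subsequence with increments below \<open>2\<^sup>-\<^sup>k\<close>. Fatou's lemma
  along this subsequence then bounds \<open>f n - g\<close> by the Cauchy estimate for \<open>f n - f (r k)\<close>.
\<close>

lemma seminorm_complete:
  fixes f :: "nat \<Rightarrow> 'a \<Rightarrow> real"
  assumes [measurable]: "\<And>n. f n \<in> borel_measurable M"
    and Cauchy: "\<And>e. 0 < e \<Longrightarrow> \<exists>K. \<forall>m\<ge>K. \<forall>n\<ge>K. N (\<lambda>\<omega>. f m \<omega> - f n \<omega>) \<le> ennreal e"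
  shows "\<exists>g\<in>borel_measurable M. \<forall>e>0. \<exists>K. \<forall>n\<ge>K. N (\<lambda>\<omega>. f n \<omega> - g \<omega>) \<le> ennreal e"
proof -
  have "\<exists>K. \<forall>m\<ge>K. \<forall>n\<ge>K. N (\<lambda>\<omega>. f m \<omega> - f n \<omega>) \<le> ennreal ((1/2)^k)" for k :: nat
    by (intro Cauchy) simp
  then obtain K where K: "\<And>k m n. K k \<le> m \<Longrightarrow> K k \<le> n \<Longrightarrow> N (\<lambda>\<omega>. f m \<omega> - f n \<omega>) \<le> ennreal ((1/2)^k)"
    by metis
  (* The partial sums of K are above K and the summand k makes r strictly increasing. *)
  define r where "r k = (\<Sum>i\<le>k. K i) + k" for k
  have r_K: "K k \<le> r k" for k
    unfolding r_def using member_le_sum[of k "{..k}" K] by simp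
  have r_mono: "r k < r (Suc k)" for k
    by (simp add: r_def)
  then have r: "strict_mono r"
    by (rule strict_monoI_Suc)
  have "(\<Sum>k. N (\<lambda>\<omega>. f (r (Suc k)) \<omega> - f (r k) \<omega>)) \<le> (\<Sum>k. ennreal ((1/2)^k))"
  proof (intro suminf_le)
    fix k
    show "N (\<lambda>\<omega>. f (r (Suc k)) \<omega> - f (r k) \<omega>) \<le> ennreal ((1/2)^k)"
      using r_mono[of k] r_K[of k] by (intro K) auto
  qed auto
  also have "\<dots> < \<infinity>"
    by (subst suminf_ennreal2) (auto simp: summable_geometric)
  finally have conv: "AE \<omega> in M. convergent (\<lambda>k. f (r k) \<omega>)"
    by (intro AE_convergent_if_summable_seminorm) auto
  define g where "g \<omega> = lim (\<lambda>k. f (r k) \<omega>)" for \<omega>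
  have g [measurable]: "g \<in> borel_measurable M"
    unfolding g_def by measurable
  show ?thesis
  proof (intro bexI[OF _ g] allI impI)
    fix e :: real assume "0 < e"
    then obtain K where K: "\<And>m n. K \<le> m \<Longrightarrow> K \<le> n \<Longrightarrow> N (\<lambda>\<omega>. f m \<omega> - f n \<omega>) \<le> ennreal e"
      using Cauchy by meson
    have "N (\<lambda>\<omega>. f n \<omega> - g \<omega>) \<le> ennreal e" if "K \<le> n" for n
    proof -
      have "N (\<lambda>\<omega>. f n \<omega> - g \<omega>) \<le> liminf (\<lambda>k. N (\<lambda>\<omega>. f n \<omega> - f (r k) \<omega>))"
        using conv
        by (intro seminorm_Fatou)
           (auto elim!: eventually_mono intro!: tendsto_diff simp: g_def convergent_LIMSEQ_iff)
      also have "\<dots> \<le> liminf (\<lambda>k. ennreal e)"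
      proof (intro Liminf_mono eventually_sequentiallyI)
        fix k assume "K \<le> k"
        then show "N (\<lambda>\<omega>. f n \<omega> - f (r k) \<omega>) \<le> ennreal e"
          using seq_suble[OF r, of k] that by (intro K) auto
      qed
      finally show ?thesis by (simp add: Liminf_const)
    qed
    then show "\<exists>K. \<forall>n\<ge>K. N (\<lambda>\<omega>. f n \<omega> - g \<omega>) \<le> ennreal e"
      by blast
  qed
qed

end

section \<open>The Banach space of classes of random variables\<close>

lemma (in normed_vector_space) Metric_space_norm_dist:
  "Metric_space (carrier V) (norm_dist V N)"
proof
  show "0 \<le> norm_dist V N x y" for x y
    by (simp add: norm_dist_def norm_nonneg)
  show "norm_dist V N x y = norm_dist V N y x" for x y
  proof (cases "x \<in> carrier V \<and> y \<in> carrier V")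
    case True
    then have "(- 1) \<odot>\<^bsub>V\<^esub> (x \<ominus>\<^bsub>V\<^esub> y) = y \<ominus>\<^bsub>V\<^esub> x"
      using smult_l_minus[of 1 "x \<ominus>\<^bsub>V\<^esub> y"] smult_one[of "x \<ominus>\<^bsub>V\<^esub> y"]
      by (simp add: class_simps carrier_class a_minus_def M.minus_add M.a_comm)
    then show ?thesis
      using True norm_smult[of "x \<ominus>\<^bsub>V\<^esub> y" "-1"] by (simp add: norm_dist_def)
  qed (auto simp: norm_dist_def)
  show "norm_dist V N x y = 0 \<longleftrightarrow> x = y" if "x \<in> carrier V" "y \<in> carrier V" for x y
    using that M.minus_equality[of x "\<ominus>\<^bsub>V\<^esub> y"]
    by (auto simp: norm_dist_def norm_eq_0_iff a_minus_def M.r_neg)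
  show "norm_dist V N x z \<le> norm_dist V N x y + norm_dist V N y z"
    if "x \<in> carrier V" "y \<in> carrier V" "z \<in> carrier V" for x y z
  proof -
    have "x \<ominus>\<^bsub>V\<^esub> z = (x \<ominus>\<^bsub>V\<^esub> y) \<oplus>\<^bsub>V\<^esub> (y \<ominus>\<^bsub>V\<^esub> z)"
      using that by (simp add: a_minus_def M.a_assoc M.r_neg1)
    then show ?thesis
      using that norm_triangle[of "x \<ominus>\<^bsub>V\<^esub> y" "y \<ominus>\<^bsub>V\<^esub> z"] by (simp add: norm_dist_def)
  qed
qed

context spectral_prob_space
begin

abbreviation cls :: "('a \<Rightarrow> real) \<Rightarrow> ('a \<Rightarrow> real) set" where
  "cls f \<equiv> as_eq M `` {f}"

text \<open>
  The negative part in \<^const>\<open>rho\<close> vanishes because quantiles of \<open>\<bar>f\<bar>\<close> are nonnegative.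
\<close>

lemma spectral_norm_cls:
  assumes [measurable]: "f \<in> borel_measurable M"
  shows "spectral_norm M \<sigma> (cls f) = enn2ereal (N f)"
proof -
  have q: "0 \<le> \<sigma> u * quantile M (\<lambda>\<omega>. \<bar>f \<omega>\<bar>) u" if "0 < u" "u < 1" for u
    using that by (intro mult_nonneg_nonneg spectral_nonneg quantile_nonneg) auto
  have "(\<integral>\<^sup>+u\<in>{0<..<1}. ennreal (- (\<sigma> u * quantile M (\<lambda>\<omega>. \<bar>f \<omega>\<bar>) u)) \<partial>lborel) = (\<integral>\<^sup>+u. 0 \<partial>(lborel :: real measure))"
    using q by (intro nn_integral_cong) (auto simp: indicator_def ennreal_neg)
  moreover have "(\<integral>\<^sup>+u\<in>{0<..<1}. ennreal (\<sigma> u * quantile M (\<lambda>\<omega>. \<bar>f \<omega>\<bar>) u) \<partial>lborel) = N f"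
    unfolding spectral_seminorm_def
    by (auto simp: nn_integral_restrict_space indicator_def ennreal_mult' spectral_nonneg
        intro!: nn_integral_cong)
  ultimately show ?thesis
    using assms by (simp add: spectral_norm_class rho_def zero_ennreal.rep_eq)
qed

lemma cls_eq_iff:
  assumes "f \<in> borel_measurable M" "g \<in> borel_measurable M"
  shows "cls f = cls g \<longleftrightarrow> (AE \<omega> in M. f \<omega> = g \<omega>)"
  using assms eq_equiv_class_iff[OF equiv_as_eq[of M] assms] by (simp add: as_eq_def)

lemma enn2ereal_less_infinity_iff: "enn2ereal a < \<infinity> \<longleftrightarrow> a < \<infinity>"
  by (simp add: less_ennreal.rep_eq top_ennreal.rep_eq top_ereal_def)

lemma cls_in_carrier_iff:
  assumes "f \<in> borel_measurable M"
  shows "cls f \<in> carrier (L_spectral M \<sigma>) \<longleftrightarrow> N f < \<infinity>"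
  using assms
  by (simp add: L_spectral_def L0_def quotientI spectral_norm_cls enn2ereal_less_infinity_iff
      less_top[symmetric])

lemma carrier_L_spectral_iff:
  "X \<in> carrier (L_spectral M \<sigma>) \<longleftrightarrow> (\<exists>f. f \<in> borel_measurable M \<and> N f < \<infinity> \<and> X = cls f)"
proof
  assume X: "X \<in> carrier (L_spectral M \<sigma>)"
  then obtain f where "f \<in> borel_measurable M" "X = cls f"
    by (auto simp: L_spectral_def L0_def elim: quotientE)
  with X cls_in_carrier_iff[of f] show "\<exists>f. f \<in> borel_measurable M \<and> N f < \<infinity> \<and> X = cls f"
    by blast
qed (auto simp: cls_in_carrier_iff)

lemma L_spectral_ops:
  assumes "f \<in> borel_measurable M" "g \<in> borel_measurable M"
  shows "cls f \<oplus>\<^bsub>L_spectral M \<sigma>\<^esub> cls g = cls (\<lambda>\<omega>. f \<omega> + g \<omega>)"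
    and "a \<odot>\<^bsub>L_spectral M \<sigma>\<^esub> cls f = cls (\<lambda>\<omega>. a * f \<omega>)"
  using assms by (simp_all add: L_spectral_def L0_add_class L0_smult_class)

lemma L_spectral_zero: "\<zero>\<^bsub>L_spectral M \<sigma>\<^esub> = cls (\<lambda>\<omega>. 0)"
  by (simp add: L_spectral_def L0_zero_def)

lemma seminorm_add_finite:
  assumes "f \<in> borel_measurable M" "g \<in> borel_measurable M" "N f < \<infinity>" "N g < \<infinity>"
  shows "N (\<lambda>\<omega>. f \<omega> + g \<omega>) < \<infinity>"
  using assms by (auto intro!: le_less_trans[OF seminorm_add_le])

lemma seminorm_cmult_finite:
  assumes "f \<in> borel_measurable M" "N f < \<infinity>"
  shows "N (\<lambda>\<omega>. c * f \<omega>) < \<infinity>"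
  using assms by (simp add: seminorm_cmult ennreal_mult_less_top)

lemma abelian_group_L_spectral: "abelian_group (L_spectral M \<sigma>)"
proof (rule abelian_groupI)
  let ?V = "L_spectral M \<sigma>"
  have N0: "N (\<lambda>\<omega>. 0) < \<infinity>"
    using seminorm_eq_0_iff[of "\<lambda>\<omega>. 0"] by simp
  show "\<zero>\<^bsub>?V\<^esub> \<in> carrier ?V"
    using N0 by (simp add: L_spectral_zero cls_in_carrier_iff)
  fix X assume "X \<in> carrier ?V"
  then obtain f where f: "f \<in> borel_measurable M" "N f < \<infinity>" "X = cls f"
    by (auto simp: carrier_L_spectral_iff)
  show "\<zero>\<^bsub>?V\<^esub> \<oplus>\<^bsub>?V\<^esub> X = X"
    using f by (simp add: L_spectral_ops L_spectral_zero)
  show "\<exists>Y\<in>carrier ?V. Y \<oplus>\<^bsub>?V\<^esub> X = \<zero>\<^bsub>?V\<^esub>"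
    using f seminorm_cmult_finite[of f "-1"]
    by (intro bexI[of _ "cls (\<lambda>\<omega>. - 1 * f \<omega>)"]) (simp_all add: L_spectral_ops L_spectral_zero cls_in_carrier_iff)
  fix Y assume "Y \<in> carrier ?V"
  then obtain g where g: "g \<in> borel_measurable M" "N g < \<infinity>" "Y = cls g"
    by (auto simp: carrier_L_spectral_iff)
  show "X \<oplus>\<^bsub>?V\<^esub> Y \<in> carrier ?V"
    using f g by (simp add: L_spectral_ops L_spectral_zero cls_in_carrier_iff seminorm_add_finite[simplified])
  show "X \<oplus>\<^bsub>?V\<^esub> Y = Y \<oplus>\<^bsub>?V\<^esub> X"
    using f g by (simp add: L_spectral_ops add.commute)
  fix Z assume "Z \<in> carrier ?V"
  then obtain h where h: "h \<in> borel_measurable M" "N h < \<infinity>" "Z = cls h"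
    by (auto simp: carrier_L_spectral_iff)
  show "X \<oplus>\<^bsub>?V\<^esub> Y \<oplus>\<^bsub>?V\<^esub> Z = X \<oplus>\<^bsub>?V\<^esub> (Y \<oplus>\<^bsub>?V\<^esub> Z)"
    using f g h by (simp add: L_spectral_ops add.assoc)
qed

lemma module_L_spectral: "Module.module (cring_class_ops :: real ring) (L_spectral M \<sigma>)"
proof (rule moduleI[OF cring_class abelian_group_L_spectral])
  let ?V = "L_spectral M \<sigma>"
  fix a b :: real and X Y
  assume "X \<in> carrier ?V"
  then obtain f where f: "f \<in> borel_measurable M" "N f < \<infinity>" "X = cls f"
    by (auto simp: carrier_L_spectral_iff)
  show "a \<odot>\<^bsub>?V\<^esub> X \<in> carrier ?V"
    using f by (simp add: L_spectral_ops L_spectral_zero cls_in_carrier_iff seminorm_cmult_finite[simplified])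
  show "(a \<oplus>\<^bsub>cring_class_ops\<^esub> b) \<odot>\<^bsub>?V\<^esub> X = a \<odot>\<^bsub>?V\<^esub> X \<oplus>\<^bsub>?V\<^esub> b \<odot>\<^bsub>?V\<^esub> X"
    using f by (simp add: L_spectral_ops class_simps distrib_right)
  show "(a \<otimes>\<^bsub>cring_class_ops\<^esub> b) \<odot>\<^bsub>?V\<^esub> X = a \<odot>\<^bsub>?V\<^esub> (b \<odot>\<^bsub>?V\<^esub> X)"
    using f by (simp add: L_spectral_ops class_simps mult.assoc)
  show "\<one>\<^bsub>cring_class_ops\<^esub> \<odot>\<^bsub>?V\<^esub> X = X"
    using f by (simp add: L_spectral_ops class_simps)
  assume "Y \<in> carrier ?V"
  then obtain g where g: "g \<in> borel_measurable M" "N g < \<infinity>" "Y = cls g"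
    by (auto simp: carrier_L_spectral_iff)
  show "a \<odot>\<^bsub>?V\<^esub> (X \<oplus>\<^bsub>?V\<^esub> Y) = a \<odot>\<^bsub>?V\<^esub> X \<oplus>\<^bsub>?V\<^esub> a \<odot>\<^bsub>?V\<^esub> Y"
    using f g by (simp add: L_spectral_ops distrib_left)
qed

abbreviation rnorm :: "('a \<Rightarrow> real) set \<Rightarrow> real" where
  "rnorm X \<equiv> real_of_ereal (spectral_norm M \<sigma> X)"

lemma rnorm_cls: "f \<in> borel_measurable M \<Longrightarrow> rnorm (cls f) = enn2real (N f)"
  by (simp only: spectral_norm_cls enn2real_def)

lemma normed_vector_space_L_spectral: "normed_vector_space (L_spectral M \<sigma>) rnorm"
proof (intro normed_vector_space.intro module_L_spectral normed_vector_space_axioms.intro)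
  let ?V = "L_spectral M \<sigma>"
  fix a :: real and X Y
  assume "X \<in> carrier ?V"
  then obtain f where f: "f \<in> borel_measurable M" "N f < \<infinity>" "X = cls f"
    by (auto simp: carrier_L_spectral_iff)
  show "0 \<le> rnorm X"
    using f by (simp add: rnorm_cls)
  show "rnorm X = 0 \<longleftrightarrow> X = \<zero>\<^bsub>?V\<^esub>"
  proof -
    have "rnorm X = 0 \<longleftrightarrow> N f = 0"
      using f by (auto simp: rnorm_cls enn2real_eq_0_iff)
    also have "\<dots> \<longleftrightarrow> X = \<zero>\<^bsub>?V\<^esub>"
      using f(1) by (simp add: f(3) L_spectral_zero cls_eq_iff seminorm_eq_0_iff)
    finally show ?thesis .
  qed
  show "rnorm (a \<odot>\<^bsub>?V\<^esub> X) = \<bar>a\<bar> * rnorm X"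
    using f by (simp add: rnorm_cls L_spectral_ops seminorm_cmult enn2real_mult)
  assume "Y \<in> carrier ?V"
  then obtain g where g: "g \<in> borel_measurable M" "N g < \<infinity>" "Y = cls g"
    by (auto simp: carrier_L_spectral_iff)
  have "enn2real (N (\<lambda>\<omega>. f \<omega> + g \<omega>)) \<le> enn2real (N f + N g)"
    using f g by (intro enn2real_mono seminorm_add_le) auto
  also have "\<dots> = enn2real (N f) + enn2real (N g)"
    using f g by (simp add: enn2real_plus)
  finally show "rnorm (X \<oplus>\<^bsub>?V\<^esub> Y) \<le> rnorm X + rnorm Y"
    using f g by (simp add: rnorm_cls L_spectral_ops L_spectral_zero)
qed

text \<open>
  Distances are finite on the carrier, so they can be computed in \<open>[0,\<infinity>]\<close> on representatives.
\<close>

lemma norm_dist_cls: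
  assumes [measurable]: "f \<in> borel_measurable M" "g \<in> borel_measurable M" and "N f < \<infinity>" "N g < \<infinity>"
  shows "ennreal (norm_dist (L_spectral M \<sigma>) rnorm (cls f) (cls g)) = N (\<lambda>\<omega>. f \<omega> - g \<omega>)"
proof -
  interpret V: normed_vector_space "L_spectral M \<sigma>" rnorm
    by (rule normed_vector_space_L_spectral)
  have carr: "cls f \<in> carrier (L_spectral M \<sigma>)" "cls g \<in> carrier (L_spectral M \<sigma>)"
      "cls (\<lambda>\<omega>. - 1 * g \<omega>) \<in> carrier (L_spectral M \<sigma>)"
    using assms seminorm_cmult_finite[of g "-1"] by (simp_all add: cls_in_carrier_iff)
  have "\<ominus>\<^bsub>L_spectral M \<sigma>\<^esub> cls g = cls (\<lambda>\<omega>. - 1 * g \<omega>)"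
    using carr by (intro V.minus_equality) (simp_all add: L_spectral_ops L_spectral_zero)
  then have "cls f \<ominus>\<^bsub>L_spectral M \<sigma>\<^esub> cls g = cls (\<lambda>\<omega>. f \<omega> - g \<omega>)"
    by (simp add: a_minus_def L_spectral_ops L_spectral_zero)
  moreover have "N (\<lambda>\<omega>. f \<omega> - g \<omega>) < \<infinity>"
    using seminorm_add_finite[of f "\<lambda>\<omega>. - 1 * g \<omega>"] seminorm_cmult_finite[of g "-1"] assms by simp
  ultimately show ?thesis
    using carr by (simp add: norm_dist_def rnorm_cls)
qed

lemma mcomplete_L_spectral:
  "Metric_space.mcomplete (carrier (L_spectral M \<sigma>)) (norm_dist (L_spectral M \<sigma>) rnorm)"
proof -
  let ?V = "L_spectral M \<sigma>"
  let ?d = "norm_dist ?V rnorm"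
  interpret V: normed_vector_space ?V rnorm
    by (rule normed_vector_space_L_spectral)
  interpret Metric_space "carrier ?V" ?d
    by (rule V.Metric_space_norm_dist)
  show ?thesis
    unfolding mcomplete_def
  proof (intro allI impI)
    fix X assume X: "MCauchy X"
    then have "\<exists>f. f \<in> borel_measurable M \<and> N f < \<infinity> \<and> X n = cls f" for n
      unfolding MCauchy_def carrier_L_spectral_iff[symmetric] by auto
    then have "\<exists>f. \<forall>n. f n \<in> borel_measurable M \<and> N (f n) < \<infinity> \<and> X n = cls (f n)"
      by (intro choice allI)
    then obtain f where *: "\<forall>n. f n \<in> borel_measurable M \<and> N (f n) < \<infinity> \<and> X n = cls (f n)" ..
    have f [measurable]: "f n \<in> borel_measurable M" and fin: "N (f n) < \<infinity>" and Xf: "X n = cls (f n)" for n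
      using * by auto
    have "\<exists>K. \<forall>m\<ge>K. \<forall>n\<ge>K. N (\<lambda>\<omega>. f m \<omega> - f n \<omega>) \<le> ennreal e" if "0 < e" for e
    proof -
      from X that obtain K where K: "\<forall>m n. K \<le> m \<longrightarrow> K \<le> n \<longrightarrow> ?d (X m) (X n) < e"
        by (auto simp only: MCauchy_def)
      have "N (\<lambda>\<omega>. f m \<omega> - f n \<omega>) \<le> ennreal e" if "K \<le> m" "K \<le> n" for m n
      proof -
        have "ennreal (?d (X m) (X n)) \<le> ennreal e"
          using K that by (intro ennreal_leI less_imp_le) blast
        then show ?thesis
          by (simp only: Xf norm_dist_cls[OF f f fin fin])
      qed
      then show ?thesis by blast
    qed
    then have "\<exists>g\<in>borel_measurable M. \<forall>e>0. \<exists>K. \<forall>n\<ge>K. N (\<lambda>\<omega>. f n \<omega> - g \<omega>) \<le> ennreal e"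
      by (rule seminorm_complete[OF f])
    then obtain g where g [measurable]: "g \<in> borel_measurable M"
      and lim: "\<And>e. 0 < e \<Longrightarrow> \<exists>K. \<forall>n\<ge>K. N (\<lambda>\<omega>. f n \<omega> - g \<omega>) \<le> ennreal e"
      by blast
    have fin_g: "N g < \<infinity>"
    proof -
      obtain n where n: "N (\<lambda>\<omega>. f n \<omega> - g \<omega>) \<le> ennreal 1"
        using lim[of 1] by auto
      (* g is the difference of f n and f n - g, both of finite norm for large n. *)
      have "N (\<lambda>\<omega>. f n \<omega> + (- 1) * (f n \<omega> - g \<omega>)) < \<infinity>"
        using n by (intro seminorm_add_finite seminorm_cmult_finite fin) (auto intro: le_less_trans)
      then show ?thesis by simp
    qed
    have "limitin mtopology X (cls g) sequentially"
      unfolding limit_metric_sequentially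
    proof (intro conjI allI impI)
      show "cls g \<in> carrier ?V"
        using fin_g by (simp add: cls_in_carrier_iff)
      fix e :: real assume e: "0 < e"
      then obtain K where K: "\<And>n. K \<le> n \<Longrightarrow> N (\<lambda>\<omega>. f n \<omega> - g \<omega>) \<le> ennreal (e / 2)"
        using lim[of "e / 2"] by auto
      have "X n \<in> carrier ?V \<and> ?d (X n) (cls g) < e" if "K \<le> n" for n
      proof
        show "X n \<in> carrier ?V"
          using fin by (simp add: Xf cls_in_carrier_iff)
        have "ennreal (?d (X n) (cls g)) \<le> ennreal (e / 2)"
          using K[OF that] by (simp only: Xf norm_dist_cls[OF f g fin fin_g])
        then show "?d (X n) (cls g) < e"
          using e by simp
      qed
      then show "\<exists>K. \<forall>n\<ge>K. X n \<in> carrier ?V \<and> ?d (X n) (cls g) < e"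
        by blast
    qed
    then show "\<exists>x. limitin mtopology X x sequentially"
      by blast
  qed
qed

end

theorem theorem20:
  fixes M :: "'a measure" and \<sigma> :: "real \<Rightarrow> real"
  assumes "prob_space M"
    and "spectral_function \<sigma>"
  shows "banach_space (L_spectral M \<sigma>) (\<lambda>X. real_of_ereal (spectral_norm M \<sigma> X))"
proof -
  interpret spectral_prob_space M \<sigma>
    using assms by (simp add: spectral_prob_space_def spectral_prob_space_axioms_def)
  show ?thesis
    by (intro banach_space.intro banach_space_axioms.intro
        normed_vector_space_L_spectral mcomplete_L_spectral)
qed

end
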